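(* Let $n$ and $k$ be integers with $n-1>k\ge 1$, and let $G$ be a $k$-connected graph of order $n$. Then \[W(G)\le \tfrac{1}{4}\,n\Big\lfloor \frac{n+k-2}{k}\Big\rfloor\Big(2n+k-2-k\Big\lfloor \frac{n+k-2}{k}\Big\rfloor\Big).\] Moreover, this bound is sharp when $k\ge 2$ is even: equality holds for the Harary graph $H_{k,n}$ (the graph on vertices $0,1,\dots,n-1$ arranged around a circle in which each vertex is adjacent to the nearest $k/2$ vertices in each direction around the circle), which is $k$-connected of order $n$.
   Context: All graphs are finite, simple and connected. A connected graph $G$ is $k$-connected if removing any $k-1$ vertices of $G$ leaves neither a disconnected graph nor a one-vertex graph. The order of $G$ is $|V(G)|$. For vertices $x,y$, $d_G(x,y)$ is the length of a shortest $x$–$y$ path. The Wiener index of $G$ is $W(G)=\sum_{\{x,y\}\subseteq V(G)} d_G(x,y)$, the sum over all unordered pairs of distinct vertices. *)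

theory Defs
  imports Complex_Main "Graph_Theory.Graph_Theory"
begin

text \<open>
  A finite simple undirected graph is an instance of the locale \<^locale>\<open>graph\<close>: a finite, symmetric
  digraph without loops and parallel arcs. An undirected edge is a pair of opposite arcs.
\<close>

text \<open>
  Meant for \<open>k \<ge> 1\<close>. The library's connectedness includes non-emptiness of the vertex set.
\<close>

definition k_connected :: "nat \<Rightarrow> ('a, 'b) pre_digraph \<Rightarrow> bool" where
  "k_connected k G \<longleftrightarrow> connected G \<and>
     (\<forall>S. S \<subseteq> verts G \<and> card S = k - 1 \<longrightarrow>
        connected (G \<restriction> (verts G - S)) \<and> card (verts (G \<restriction> (verts G - S))) \<noteq> 1)"

text \<open>Unspecified if there is no path from \<open>x\<close> to \<open>y\<close>.\<close>

definition graph_dist :: "('a, 'b) pre_digraph \<Rightarrow> 'a \<Rightarrow> 'a \<Rightarrow> nat" where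
  "graph_dist G x y = (LEAST l. \<exists>p. pre_digraph.apath G x p y \<and> length p = l)"

text \<open>
  The sum ranges over unordered pairs. The description is well-defined because the distance in a
  graph is symmetric, see \<open>wiener_index_eq_half_ordered\<close> below.
\<close>

definition wiener_index :: "('a, 'b) pre_digraph \<Rightarrow> nat" where
  "wiener_index G =
     (\<Sum>P | P \<subseteq> verts G \<and> card P = 2. THE d. \<exists>x y. P = {x, y} \<and> d = graph_dist G x y)"

text \<open>
  \<open>(i + d) mod n\<close> is the \<open>d\<close>-th vertex after \<open>i\<close> around the circle. Meant for even \<open>k < n\<close>.
\<close>

definition harary :: "nat \<Rightarrow> nat \<Rightarrow> nat pair_pre_digraph" where
  "harary k n = \<lparr> pverts = {..<n},
     parcs = {(i, j). i < n \<and> j < n \<and>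
       (\<exists>d\<in>{1..k div 2}. j = (i + d) mod n \<or> i = (j + d) mod n)} \<rparr>"

lemma (in graph) apath_rev_ex:
  assumes "apath u p v"
  shows "\<exists>q. apath v q u \<and> length q = length p"
proof -
  have "\<exists>q. awalk v q u \<and> length q = length p \<and> awalk_verts v q = rev (awalk_verts u p)"
    if "awalk u p v" for u p v
    using that
  proof (induction p arbitrary: u)
    case Nil
    then show ?case by (auto simp: awalk_Nil_iff intro!: exI[of _ "[]"])
  next
    case (Cons e p)
    then have e: "e \<in> arcs G" "tail G e = u" "awalk (head G e) p v"
      by (auto simp: awalk_Cons_iff)
    with Cons.IH obtain q where q: "awalk v q (head G e)" "length q = length p"
      "awalk_verts v q = rev (awalk_verts (head G e) p)" by blast
    have "(head G e, u) \<in> arcs_ends G"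
      using e sym_arcs unfolding symmetric_def sym_def by (metis in_arcs_imp_in_arcs_ends)
    then obtain f where f: "f \<in> arcs G" "tail G f = head G e" "head G f = u"
      by (auto simp: arcs_ends_conv)
    then have aw: "awalk v (q @ [f]) u"
      using q(1) e by (auto simp: awalk_simps intro: wellformed)
    moreover have "awalk_verts v (q @ [f]) = rev (awalk_verts u (e # p))"
      using aw q f e by (auto simp: awalk_verts_append)
    ultimately show ?case using q(2) by (intro exI[of _ "q @ [f]"]) auto
  qed
  with assms show ?thesis unfolding apath_def by (metis distinct_rev)
qed

lemma (in graph) graph_dist_sym: "graph_dist G x y = graph_dist G y x"
proof -
  have "(\<exists>p. apath x p y \<and> length p = l) \<longleftrightarrow> (\<exists>p. apath y p x \<and> length p = l)" for l
    using apath_rev_ex by metis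
  then show ?thesis by (simp add: graph_dist_def)
qed

lemma (in graph) wiener_index_eq_half_ordered:
  "2 * wiener_index G = (\<Sum>(x, y) | x \<in> verts G \<and> y \<in> verts G \<and> x \<noteq> y. graph_dist G x y)"
proof -
  let ?A = "{(x, y). x \<in> verts G \<and> y \<in> verts G \<and> x \<noteq> y}"
  let ?B = "{P. P \<subseteq> verts G \<and> card P = 2}"
  let ?d = "\<lambda>P. THE d. \<exists>x y. P = {x, y} \<and> d = graph_dist G x y"
  have fA: "finite ?A"
    by (rule finite_subset[of _ "verts G \<times> verts G"]) auto
  have fB: "finite ?B" by simp
  have im: "(\<lambda>(x, y). {x, y}) ` ?A \<subseteq> ?B" by auto
  have "(\<Sum>(x, y)\<in>?A. graph_dist G x y)
      = (\<Sum>P\<in>?B. \<Sum>(x, y) | (x, y) \<in> ?A \<and> (\<lambda>(x, y). {x, y}) (x, y) = P. graph_dist G x y)"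
    using sum.group[OF fA fB im, of "\<lambda>(x, y). graph_dist G x y"]
    by (simp add: case_prod_unfold)
  also have "\<dots> = (\<Sum>P\<in>?B. 2 * ?d P)"
  proof (rule sum.cong[OF refl])
    fix P assume "P \<in> ?B"
    then obtain a b where ab: "P = {a, b}" "a \<noteq> b" "a \<in> verts G" "b \<in> verts G"
      by (auto simp: card_2_iff)
    have "{(x, y). (x, y) \<in> ?A \<and> (\<lambda>(x, y). {x, y}) (x, y) = P} = {(a, b), (b, a)}"
      using ab by (auto simp: doubleton_eq_iff)
    moreover have "?d P = graph_dist G a b"
      using ab by (intro the_equality) (auto simp: doubleton_eq_iff graph_dist_sym)
    ultimately show "(\<Sum>(x, y) | (x, y) \<in> ?A \<and> (\<lambda>(x, y). {x, y}) (x, y) = P. graph_dist G x y)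
        = 2 * ?d P"
      using ab by (simp add: graph_dist_sym[of b a])
  qed
  finally show ?thesis by (simp add: wiener_index_def sum_distrib_left)
qed

end

theory Submission
  imports Defs
begin

text \<open>
  Fix a vertex \<open>x\<close>. By \<open>k\<close>-connectivity every distance layer around \<open>x\<close>, except the centre and the
  last one, has at least \<open>k\<close> vertices, because it separates \<open>x\<close> from everything farther away.
  Hence at most \<open>n - 1 - k * i\<close> vertices (truncated) have distance more than \<open>i\<close> from \<open>x\<close>, and
  summing over \<open>i\<close> bounds the sum of the distances from \<open>x\<close>; summing over \<open>x\<close> counts every pair
  twice. In the Harary graph with \<open>k = 2 * m\<close> the ball of radius \<open>i\<close> has at most \<open>2 * m * i + 1\<close>
  vertices, so all these estimates are equalities.
  The Harary graph is \<open>k\<close>-connected: of the two circular arcs between \<open>u\<close> and \<open>v\<close>, one contains fewer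
  than \<open>m\<close> of the \<open>2 * m - 1\<close> removed vertices, and one can jump over them.
\<close>

section \<open>Distances in graphs\<close>

lemma (in wf_digraph) length_awalk_to_apath_le:
  assumes "awalk u p v"
  shows "length (awalk_to_apath p) \<le> length p"
  using assms
proof (induct rule: awalk_to_apath_induct)
  case (path p)
  then have "awalk_to_apath p = p"
    by (auto simp: awalk_to_apath.simps)
  then show ?case by simp
next
  case (decomp p q r s)
  have "p = q @ r @ s"
    using decomp by (auto elim!: awalk_cyc_decompE)
  then show ?case
    using decomp step_awalk_to_apath[of u p v q r s] by simp
qed

text \<open>\<open>graph_dist\<close> minimises over paths, but only walks concatenate freely.
  Cutting the cycles out of a walk never lengthens it, so walks also bound the distance.\<close>

lemma (in wf_digraph) graph_dist_le_length:
  assumes "awalk u p v"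
  shows "graph_dist G u v \<le> length p"
proof -
  have "graph_dist G u v \<le> length (awalk_to_apath p)"
    unfolding graph_dist_def using apath_awalk_to_apath[OF assms] by (intro Least_le) blast
  with length_awalk_to_apath_le[OF assms] show ?thesis by simp
qed

lemma (in wf_digraph) obtain_shortest_apath:
  assumes "u \<rightarrow>\<^sup>* v"
  obtains p where "apath u p v" "length p = graph_dist G u v"
proof -
  have "\<exists>l p. apath u p v \<and> length p = l"
    using assms by (auto simp: reachable_apath)
  then have "\<exists>p. apath u p v \<and> length p = graph_dist G u v"
    unfolding graph_dist_def by (rule LeastI_ex)
  then show ?thesis using that by blast
qed

lemma (in wf_digraph) graph_dist_self:
  "u \<in> verts G \<Longrightarrow> graph_dist G u u = 0"
  using graph_dist_le_length[of u "[]" u] by (simp add: awalk_Nil_iff)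

lemma (in wf_digraph) graph_dist_adj_le:
  assumes "u \<rightarrow>\<^sup>* v" "v \<rightarrow> w"
  shows "graph_dist G u w \<le> Suc (graph_dist G u v)"
proof -
  obtain p where p: "apath u p v" "length p = graph_dist G u v"
    using obtain_shortest_apath[OF assms(1)] .
  obtain e where e: "e \<in> arcs G" "tail G e = v" "head G e = w"
    using assms(2) by (rule reachableE)
  have "awalk u p v" using p(1) by (rule awalkI_apath)
  moreover have "awalk v [e] w" using e by (auto simp: awalk_simps)
  ultimately have "awalk u (p @ [e]) w" by (rule awalk_appendI)
  from graph_dist_le_length[OF this] p(2) show ?thesis by simp
qed

text \<open>\<open>connected\<close> refers to the symmetric closure of the arcs; since the arcs are
  already symmetric, directed reachability says the same.\<close>

lemma (in graph) connected_iff_reachable: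
  "connected G \<longleftrightarrow> verts G \<noteq> {} \<and> (\<forall>u\<in>verts G. \<forall>v\<in>verts G. u \<rightarrow>\<^sup>* v)"
proof
  assume "connected G"
  with sym_arcs have "strongly_connected G"
    by (intro symmetric_connected_imp_strongly_connected)
  then show "verts G \<noteq> {} \<and> (\<forall>u\<in>verts G. \<forall>v\<in>verts G. u \<rightarrow>\<^sup>* v)"
    by (simp add: strongly_connected_def)
next
  assume *: "verts G \<noteq> {} \<and> (\<forall>u\<in>verts G. \<forall>v\<in>verts G. u \<rightarrow>\<^sup>* v)"
  have "(u, v) \<in> rtrancl_on (verts G) ((arcs_ends G)\<^sup>s)" if "u \<rightarrow>\<^sup>* v" for u v
    using that unfolding reachable_def by (rule rtrancl_on_mono[rotated 2]) (auto simp: symcl_def)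
  with * show "connected G" by (simp add: connected_conv)
qed

lemma (in graph) graph_induce_subgraph:
  assumes "S \<subseteq> verts G"
  shows "graph (G \<restriction> S)"
proof -
  interpret H: wf_digraph "G \<restriction> S" by (rule wellformed_induce_subgraph)
  have "symmetric (G \<restriction> S)"
    using sym_arcs induced_induce[OF assms] by (rule induced_graph_imp_symmetric)
  then show ?thesis
    using assms finite_subset[OF assms] no_loops no_multi_arcs
    by unfold_locales auto
qed

section \<open>The upper bound\<close>

text \<open>A layer with fewer than \<open>k\<close> vertices would be a separator: distances from
  \<open>x\<close> grow by at most one along an arc, so a walk avoiding layer \<open>i\<close> never
  gets past it.\<close>

lemma (in graph) card_layer_ge:
  assumes "k_connected k G" "k < card (verts G)" "1 \<le> k"
    and "x \<in> verts G" "y \<in> verts G" "0 < i" "i < graph_dist G x y"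
  shows "k \<le> card {z \<in> verts G. graph_dist G x z = i}" (is "k \<le> card ?L")
proof (rule ccontr)
  assume "\<not> k \<le> card ?L"
  then have card_L: "card ?L \<le> k - 1" by simp
  have neq: "x \<noteq> y" using assms graph_dist_self by auto
  have "?L \<subseteq> verts G - {x, y}" using assms graph_dist_self by auto
  \<comment> \<open>\<open>k_connected\<close> speaks only of sets of exactly \<open>k - 1\<close>
    vertices, so the layer must be padded to that size without using \<open>x\<close> or
    \<open>y\<close>.\<close>
  moreover have "k - 1 \<le> card (verts G - {x, y})"
    using assms neq by (simp add: card_Diff_subset)
  ultimately obtain S where S: "?L \<subseteq> S" "S \<subseteq> verts G - {x, y}" "card S = k - 1"
    using card_L exists_subset_between[of ?L "k - 1" "verts G - {x, y}"] by auto
  let ?H = "G \<restriction> (verts G - S)"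
  interpret H: graph ?H by (rule graph_induce_subgraph) simp
  have "connected ?H"
    using assms S unfolding k_connected_def by blast
  moreover have "x \<in> verts ?H" "y \<in> verts ?H" using assms S by auto
  ultimately have "x \<rightarrow>\<^sup>*\<^bsub>?H\<^esub> y"
    unfolding H.connected_iff_reachable by blast
  \<comment> \<open>Invariant along a walk in \<open>?H\<close>: the distance from \<open>x\<close>,
    measured in \<open>G\<close>, stays below \<open>i\<close>, because it would have to take the
    value \<open>i\<close> first.\<close>
  then have "graph_dist G x y < i"
  proof (induct rule: H.reachable_induct)
    case base
    then show ?case using assms graph_dist_self by simp
  next
    case (step z w)
    have "x \<rightarrow>\<^sup>* z" using step(1) by (rule reachable_induce_subgraphD) simp
    moreover have "z \<rightarrow> w" using step(2) by (rule dominates_induce_subgraphD)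
    ultimately have "graph_dist G x w \<le> Suc (graph_dist G x z)"
      by (rule graph_dist_adj_le)
    moreover have "graph_dist G x w \<noteq> i"
      using H.adj_in_verts(2)[OF step(2)] S(1) by auto
    ultimately show ?case using step(3) by simp
  qed
  with assms show False by simp
qed

lemma (in graph) card_far_le:
  assumes "k_connected k G" "k < card (verts G)" "1 \<le> k" "x \<in> verts G"
  shows "card {y \<in> verts G. i < graph_dist G x y} \<le> card (verts G) - 1 - k * i"
proof (induct i)
  case 0
  have "card {y \<in> verts G. 0 < graph_dist G x y} \<le> card (verts G - {x})"
    using assms graph_dist_self by (intro card_mono) auto
  then show ?case using assms by simp
next
  case (Suc i)
  let ?M = "\<lambda>i. {y \<in> verts G. i < graph_dist G x y}"
  let ?L = "{y \<in> verts G. graph_dist G x y = Suc i}"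
  show ?case
  \<comment> \<open>A vertex beyond layer \<open>Suc i\<close> is what makes that layer have
    \<open>k\<close> vertices; if there is none, the truncated bound holds trivially.\<close>
  proof (cases "?M (Suc i) = {}")
    case False
    then obtain y where "y \<in> verts G" "Suc i < graph_dist G x y" by blast
    then have "k \<le> card ?L" using card_layer_ge[of k x y "Suc i"] assms by simp
    moreover have "card (?M i) = card ?L + card (?M (Suc i))"
    proof -
      have "?M i = ?L \<union> ?M (Suc i)" by auto
      then show ?thesis by (simp add: card_Un_disjoint disjoint_iff)
    qed
    ultimately show ?thesis using Suc by (simp add: algebra_simps)
  next
    case True
    then show ?thesis by (simp only: card.empty)
  qed
qed

section \<open>Distance sums counted by layers\<close>

text \<open>Each \<open>f y\<close> is the number of \<open>i\<close> below it; exchanging the two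
  summations gives the identity.\<close>

lemma sum_eq_sum_card_less:
  fixes f :: "'a \<Rightarrow> nat"
  assumes "finite A" "\<And>y. y \<in> A \<Longrightarrow> f y \<le> N"
  shows "(\<Sum>y\<in>A. f y) = (\<Sum>i<N. card {y \<in> A. i < f y})"
proof -
  have "f y = (\<Sum>i<N. if i < f y then 1 else 0)" if "y \<in> A" for y
  proof -
    have "{i. i < N \<and> i < f y} = {..<f y}" using assms(2)[OF that] by auto
    then show ?thesis by (simp add: sum.If_cases lessThan_def Int_def)
  qed
  then have "(\<Sum>y\<in>A. f y) = (\<Sum>y\<in>A. \<Sum>i<N. if i < f y then 1 else 0)"
    by (rule sum.cong[OF refl])
  also have "\<dots> = (\<Sum>i<N. \<Sum>y\<in>A. if i < f y then 1 else 0)" by (rule sum.swap)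
  also have "\<dots> = (\<Sum>i<N. card {y \<in> A. i < f y})"
    using assms(1) by (simp add: sum.If_cases Int_def)
  finally show ?thesis .
qed

lemma (in graph) double_wiener_index_eq:
  assumes "connected G"
  shows "2 * wiener_index G =
    (\<Sum>x\<in>verts G. \<Sum>i<card (verts G). card {y \<in> verts G. i < graph_dist G x y})"
proof -
  have "2 * wiener_index G
      = (\<Sum>(x, y)\<in>Sigma (verts G) (\<lambda>x. verts G - {x}). graph_dist G x y)"
    unfolding wiener_index_eq_half_ordered by (rule sum.cong) auto
  also have "\<dots> = (\<Sum>x\<in>verts G. \<Sum>y\<in>verts G - {x}. graph_dist G x y)"
    by (rule sum.Sigma[symmetric]) auto
  also have "\<dots> = (\<Sum>x\<in>verts G. \<Sum>y\<in>verts G. graph_dist G x y)"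
    by (intro sum.cong refl sum.mono_neutral_left) (auto simp: graph_dist_self)
  also have "\<dots> = (\<Sum>x\<in>verts G. \<Sum>i<card (verts G). card {y \<in> verts G. i < graph_dist G x y})"
  proof (intro sum.cong refl sum_eq_sum_card_less finite_verts)
    fix x y assume "x \<in> verts G" "y \<in> verts G"
    with assms have "x \<rightarrow>\<^sup>* y" by (simp add: connected_iff_reachable)
    then obtain p where "apath x p y" "length p = graph_dist G x y"
      by (rule obtain_shortest_apath)
    then show "graph_dist G x y \<le> card (verts G)" using length_apath[of x p y] by simp
  qed
  finally show ?thesis .
qed

lemma (in graph) double_wiener_index_le:
  assumes "k_connected k G" "k < card (verts G)" "1 \<le> k"
  shows "2 * wiener_index G \<le> card (verts G) * (\<Sum>i<card (verts G). card (verts G) - 1 - k * i)"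
proof -
  have "2 * wiener_index G
      = (\<Sum>x\<in>verts G. \<Sum>i<card (verts G). card {y \<in> verts G. i < graph_dist G x y})"
    using assms double_wiener_index_eq by (simp add: k_connected_def)
  also have "\<dots> \<le> (\<Sum>x\<in>verts G. \<Sum>i<card (verts G). card (verts G) - 1 - k * i)"
    using card_far_le[of k] assms by (intro sum_mono) auto
  finally show ?thesis by simp
qed

text \<open>Here \<open>q\<close> is (n - 1) / k rounded up, the number of nonzero terms. On these
  the subtraction is not truncated, so an arithmetic progression remains.\<close>

lemma sum_truncated_arith_progression:
  fixes n k :: nat
  assumes "1 \<le> k" "2 \<le> n" and q: "q = (n + k - 2) div k"
  shows "2 * real (\<Sum>i<n. n - 1 - k * i) = real q * (2 * real n + real k - 2 - real k * real q)"
proof -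
  have less_q: "i < q \<longleftrightarrow> k * i < n - 1" for i
  proof -
    have "i < q \<longleftrightarrow> Suc i * k \<le> n + k - 2"
      unfolding q using assms by (simp add: less_eq_div_iff_mult_less_eq Suc_le_eq[symmetric])
    also have "\<dots> \<longleftrightarrow> k * i < n - 1" using assms by (auto simp: algebra_simps)
    finally show ?thesis .
  qed
  have "q \<le> n"
  proof (rule ccontr)
    assume "\<not> q \<le> n"
    then have "k * n < n - 1" using less_q[of n] by simp
    moreover have "n \<le> k * n" using assms mult_le_mono1[of 1 k n] by simp
    ultimately show False by linarith
  qed
  then have "(\<Sum>i<n. n - 1 - k * i) = (\<Sum>i<q. n - 1 - k * i)"
    by (intro sum.mono_neutral_right) (auto simp: less_q simp flip: not_less)
  also have "real \<dots> = (\<Sum>i<q. real n - 1 - real k * real i)"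
    unfolding of_nat_sum
  proof (rule sum.cong[OF refl])
    fix i assume "i \<in> {..<q}"
    then have "k * i \<le> n - 1" using less_q by (simp add: less_imp_le)
    then show "real (n - 1 - k * i) = real n - 1 - real k * real i"
      using assms by simp
  qed
  \<comment> \<open>This identity over the reals holds for every \<open>q\<close>, so the induction
    ignores its definition.\<close>
  also have "2 * \<dots> = real q * (2 * real n + real k - 2 - real k * real q)"
    by (induct q) (simp_all add: algebra_simps)
  finally show ?thesis .
qed

section \<open>Harary graphs\<close>

lemma pverts_harary [simp]: "pverts (harary k n) = {..<n}"
  by (simp add: harary_def)

lemma graph_harary:
  assumes "k div 2 < n"
  shows "graph (with_proj (harary k n))"
proof -
  have sub: "parcs (harary k n) \<subseteq> {..<n} \<times> {..<n}"
    by (auto simp: harary_def)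
  then have "finite (parcs (harary k n))"
    by (rule finite_subset) simp
  moreover have "symmetric (with_proj (harary k n))"
    by (auto simp: symmetric_def harary_def intro!: symI)
  moreover have "e \<in> parcs (harary k n) \<Longrightarrow> fst e \<noteq> snd e" for e
  proof -
    \<comment> \<open>No loops: a jump shorter than a full turn wraps around at most once and cannot
      return to its start.\<close>
    have "(i + d) mod n \<noteq> i" if "i < n" "d \<in> {1..k div 2}" for i d
      using that assms by (cases "i + d < n") (auto simp: le_mod_geq)
    then show "e \<in> parcs (harary k n) \<Longrightarrow> fst e \<noteq> snd e"
      by (fastforce simp: harary_def)
  qed
  ultimately interpret pair_graph "harary k n"
    using sub by unfold_locales auto
  show ?thesis by (rule pair_graphD_graph)
qed

section \<open>Balls in Harary graphs\<close>

text \<open>Each arc shifts the position by at most \<open>k div 2\<close> in either direction.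
  Adding the signed shifts as integers bounds the total shift, and thereby the size of
  balls.\<close>

lemma harary_awalk_displacement:
  assumes "pre_digraph.awalk (with_proj (harary k n)) u p v"
  shows "\<exists>t. \<bar>t\<bar> \<le> int (length p * (k div 2)) \<and> int v = (int u + t) mod int n"
  using assms
proof (induct p arbitrary: u)
  case Nil
  then have "v = u" "u < n"
    by (auto simp: pre_digraph.awalk_def harary_def pre_digraph.cas.simps)
  then show ?case by (intro exI[of _ 0]) simp
next
  case (Cons e p)
  then have e: "e \<in> parcs (harary k n)" "fst e = u"
    and "pre_digraph.awalk (with_proj (harary k n)) (snd e) p v"
    by (auto simp: pre_digraph.awalk_def harary_def pre_digraph.cas.simps)
  with Cons(1) obtain t where t: "\<bar>t\<bar> \<le> int (length p * (k div 2))" "int v = (int (snd e) + t) mod int n"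
    by blast
  obtain w where w: "e = (u, w)" using e by (cases e) auto
  obtain d where d: "d \<in> {1..k div 2}" "w < n" "w = (u + d) mod n \<or> u = (w + d) mod n"
    using e by (auto simp: w harary_def)
  have "\<exists>s. \<bar>s\<bar> \<le> int (k div 2) \<and> int w = (int u + s) mod int n"
    using d(3)
  proof
    assume "w = (u + d) mod n"
    then show ?thesis using d by (intro exI[of _ "int d"]) (simp add: zmod_int)
  next
    assume "u = (w + d) mod n"
    then have "(int u - int d) mod int n = int w mod int n"
      by (simp add: zmod_int mod_simps)
    then show ?thesis using d by (intro exI[of _ "- int d"]) simp
  qed
  then obtain s where s: "\<bar>s\<bar> \<le> int (k div 2)" "int w = (int u + s) mod int n" by blast
  have "int v = (int u + (s + t)) mod int n"
    using t(2) s(2) by (simp add: w mod_simps add.assoc)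
  moreover have "\<bar>s + t\<bar> \<le> int (length (e # p) * (k div 2))"
    using s(1) t(1) by (simp add: algebra_simps)
  ultimately show ?case by blast
qed

lemma card_far_harary_ge:
  assumes "k div 2 < n" "connected (with_proj (harary k n))" "x < n"
  shows "n - 1 - 2 * (k div 2) * i \<le>
    card {y \<in> verts (with_proj (harary k n)). i < graph_dist (with_proj (harary k n)) x y}"
    (is "_ \<le> card ?M")
proof -
  let ?G = "with_proj (harary k n)" and ?m = "k div 2"
  interpret graph ?G using assms(1) by (rule graph_harary)
  let ?B = "{y \<in> verts ?G. graph_dist ?G x y \<le> i}"
  let ?T = "{- int (i * ?m)..int (i * ?m)}"
  \<comment> \<open>A shortest path to a vertex of the ball has at most \<open>i\<close> arcs, so
    that vertex is \<open>x\<close> shifted by one of the \<open>2 * ?m * i + 1\<close> integers in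
    \<open>?T\<close>.\<close>
  have "?B \<subseteq> (\<lambda>t. nat ((int x + t) mod int n)) ` ?T"
  proof
    fix y assume y: "y \<in> ?B"
    then have "x \<rightarrow>\<^sup>*\<^bsub>?G\<^esub> y"
      using assms(2,3) by (auto simp: connected_iff_reachable)
    then obtain p where p: "apath x p y" "length p = graph_dist ?G x y"
      by (rule obtain_shortest_apath)
    obtain t where t: "\<bar>t\<bar> \<le> int (length p * ?m)" "int y = (int x + t) mod int n"
      using harary_awalk_displacement[OF awalkI_apath[OF p(1)]] by blast
    have "length p * ?m \<le> i * ?m" using p(2) y by (intro mult_le_mono1) simp
    then have "\<bar>t\<bar> \<le> int (i * ?m)" using t(1) by linarith
    moreover have "y = nat ((int x + t) mod int n)" using t(2) by simp
    ultimately show "y \<in> (\<lambda>t. nat ((int x + t) mod int n)) ` ?T"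
      by (intro rev_image_eqI[of t]) auto
  qed
  then have "card ?B \<le> card ?T" by (intro surj_card_le) auto
  also have "\<dots> = 2 * ?m * i + 1" by (simp add: nat_add_distrib nat_mult_distrib)
  finally have "card ?B \<le> 2 * ?m * i + 1" .
  moreover have "card ?B + card ?M = n"
  proof -
    have "?B \<union> ?M = verts ?G" by auto
    then have "card (?B \<union> ?M) = n" by simp
    moreover have "card (?B \<union> ?M) = card ?B + card ?M"
      by (rule card_Un_disjoint) auto
    ultimately show ?thesis by simp
  qed
  ultimately show ?thesis by simp
qed

lemma double_wiener_index_harary_ge:
  assumes "k div 2 < n" "connected (with_proj (harary k n))"
  shows "n * (\<Sum>i<n. n - 1 - 2 * (k div 2) * i) \<le> 2 * wiener_index (with_proj (harary k n))"
proof -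
  let ?G = "with_proj (harary k n)"
  interpret graph ?G using assms(1) by (rule graph_harary)
  have "n * (\<Sum>i<n. n - 1 - 2 * (k div 2) * i) = (\<Sum>x\<in>verts ?G. \<Sum>i<n. n - 1 - 2 * (k div 2) * i)"
    by simp
  also have "\<dots> \<le> (\<Sum>x\<in>verts ?G. \<Sum>i<n. card {y \<in> verts ?G. i < graph_dist ?G x y})"
    using assms by (intro sum_mono card_far_harary_ge) auto
  also have "\<dots> = 2 * wiener_index ?G"
    using double_wiener_index_eq[OF assms(2)] by simp
  finally show ?thesis .
qed

section \<open>Connectivity of Harary graphs\<close>

text \<open>The circle is unrolled onto the natural numbers, so that an arc passing 0 is still an
  interval. With fewer than \<open>k div 2\<close> deleted positions in between, some permitted jump
  always lands on a surviving vertex closer to \<open>b\<close>.\<close>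

lemma harary_reachable_along_arc:
  assumes "k div 2 < n" and S: "S \<subseteq> {..<n}"
    and "a mod n \<notin> S" "b mod n \<notin> S" "a \<le> b"
    and "card {t \<in> {a<..<b}. t mod n \<in> S} < k div 2"
  shows "(a mod n) \<rightarrow>\<^sup>*\<^bsub>with_proj (harary k n) \<restriction> (verts (with_proj (harary k n)) - S)\<^esub> (b mod n)"
  using assms(3-)
proof (induct "b - a" arbitrary: a rule: less_induct)
  case less
  let ?G = "with_proj (harary k n)" and ?m = "k div 2"
  let ?H = "?G \<restriction> (verts ?G - S)"
  interpret G: graph ?G using assms(1) by (rule graph_harary)
  interpret H: graph ?H by (rule G.graph_induce_subgraph) simp
  have n: "0 < n" using assms(1) by simp
  have adj: "(a mod n) \<rightarrow>\<^bsub>?H\<^esub> (c mod n)" if "a < c" "c \<le> a + ?m" "c mod n \<notin> S" for c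
  proof -
    have "c mod n = (a mod n + (c - a)) mod n" using that by (simp only: mod_add_left_eq) simp
    then have "(a mod n, c mod n) \<in> parcs (harary k n)"
      using that n unfolding harary_def by (auto intro!: bexI[of _ "c - a"])
    then show ?thesis using that less.prems n by (auto simp: arcs_ends_conv image_iff)
  qed
  show ?case
  proof (cases "b \<le> a + ?m")
    case True
    show ?thesis
    proof (cases "a = b")
      case True
      then show ?thesis using less.prems n H.reachable_refl[of "a mod n"] by simp
    next
      case False
      then show ?thesis using H.reachable_adjI[OF adj[of b]] True less.prems by simp
    qed
  next
    case False
    \<comment> \<open>All \<open>?m\<close> positions after \<open>a\<close> lie before
      \<open>b\<close>, and fewer than \<open>?m\<close> of these are deleted.\<close>
    have "\<exists>c\<in>{a<..a + ?m}. c mod n \<notin> S"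
    proof (rule ccontr)
      assume "\<not> ?thesis"
      then have "{a<..a + ?m} \<subseteq> {t \<in> {a<..<b}. t mod n \<in> S}" using False by auto
      then have "card {a<..a + ?m} \<le> card {t \<in> {a<..<b}. t mod n \<in> S}"
        by (intro card_mono) auto
      with less.prems show False by simp
    qed
    then obtain c where c: "a < c" "c \<le> a + ?m" "c mod n \<notin> S" by auto
    have "card {t \<in> {c<..<b}. t mod n \<in> S} \<le> card {t \<in> {a<..<b}. t mod n \<in> S}"
      using c by (intro card_mono) auto
    then have "(c mod n) \<rightarrow>\<^sup>*\<^bsub>?H\<^esub> (b mod n)"
      using less.hyps[of c] less.prems c False by auto
    with adj[OF c] show ?thesis by (rule H.adj_reachable_trans)
  qed
qed

lemma harary_delete_connected:
  assumes "even k" "k < n" and S: "S \<subseteq> {..<n}" "card S < k"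
  shows "connected (with_proj (harary k n) \<restriction> (verts (with_proj (harary k n)) - S))"
proof -
  let ?G = "with_proj (harary k n)" and ?m = "k div 2"
  let ?H = "?G \<restriction> (verts ?G - S)"
  have mn: "?m < n" using assms by simp
  interpret G: graph ?G using mn by (rule graph_harary)
  interpret H: graph ?H by (rule G.graph_induce_subgraph) simp
  have finS: "finite S" using S finite_subset by blast
  have reach: "u \<rightarrow>\<^sup>*\<^bsub>?H\<^esub> v" if uv: "u < v" "v < n" "u \<notin> S" "v \<notin> S" for u v
  proof -
    \<comment> \<open>The deleted positions on the two arcs; the second arc runs from
      \<open>v\<close> past 0 to \<open>u + n\<close>, another position of the vertex
      \<open>u\<close>.\<close>
    let ?A = "{t \<in> {u<..<v}. t mod n \<in> S}" and ?B = "{t \<in> {v<..<u + n}. t mod n \<in> S}"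
    have inj: "inj_on (\<lambda>t. t mod n) {u<..<u + n}"
    proof (rule linorder_inj_onI')
      fix t t' assume t: "t \<in> {u<..<u + n}" "t' \<in> {u<..<u + n}" "t < t'"
      show "t mod n \<noteq> t' mod n"
      proof
        assume "t mod n = t' mod n"
        then have "n dvd t' - t" using t by (metis less_imp_le mod_eq_dvd_iff_nat)
        then have "n \<le> t' - t" using t by (intro dvd_imp_le) auto
        with t show False by auto
      qed
    qed
    \<comment> \<open>Both arcs lie within fewer than \<open>n\<close> consecutive positions, so no
      vertex of \<open>S\<close> is counted twice.\<close>
    have "card (?A \<union> ?B) = card ((\<lambda>t. t mod n) ` (?A \<union> ?B))"
      by (rule card_image[symmetric], rule inj_on_subset[OF inj]) (use uv in auto)
    also have "\<dots> \<le> card S" using finS by (intro card_mono) auto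
    finally have "card (?A \<union> ?B) \<le> card S" .
    moreover have "card (?A \<union> ?B) = card ?A + card ?B"
      by (intro card_Un_disjoint) auto
    \<comment> \<open>The two counts sum to less than \<open>k\<close>, which is
      \<open>2 * ?m\<close> as \<open>k\<close> is even.\<close>
    ultimately consider "card ?A < ?m" | "card ?B < ?m"
      using S(2) \<open>even k\<close> by fastforce
    then show ?thesis
    proof cases
      case 1
      then show ?thesis using harary_reachable_along_arc[OF mn S(1), of u v] uv by simp
    next
      case 2
      then have "v \<rightarrow>\<^sup>*\<^bsub>?H\<^esub> u"
        using harary_reachable_along_arc[OF mn S(1), of v "u + n"] uv by simp
      then show ?thesis by (rule H.symmetric_reachable')
    qed
  qed
  have "S \<noteq> {..<n}" using S assms by auto
  moreover have "u \<rightarrow>\<^sup>*\<^bsub>?H\<^esub> v" if "u < n" "v < n" "u \<notin> S" "v \<notin> S" for u v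
    using reach[of u v] H.symmetric_reachable'[OF reach[of v u]] H.reachable_refl[of u] that
    by (cases u v rule: linorder_cases) (simp_all add: harary_def)
  ultimately show ?thesis
    using S unfolding H.connected_iff_reachable by auto
qed

lemma k_connected_harary:
  assumes "even k" "2 \<le> k" "k < n - 1"
  shows "k_connected k (with_proj (harary k n))"
proof -
  let ?G = "with_proj (harary k n)"
  have "?G \<restriction> (verts ?G - {}) = ?G"
    by (auto simp: induce_subgraph_def with_proj_def harary_def)
  then have "connected ?G"
    using harary_delete_connected[of k n "{}"] assms by simp
  moreover have "connected (?G \<restriction> (verts ?G - S)) \<and> card (verts (?G \<restriction> (verts ?G - S))) \<noteq> 1"
    if "S \<subseteq> verts ?G \<and> card S = k - 1" for S
  proof
    show "connected (?G \<restriction> (verts ?G - S))"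
      using that assms by (intro harary_delete_connected) auto
    \<comment> \<open>At least three vertices survive, since \<open>n\<close> is at least
      \<open>k + 2\<close>.\<close>
    have "finite S" using that finite_subset by auto
    then show "card (verts (?G \<restriction> (verts ?G - S))) \<noteq> 1"
      using that assms by (simp add: card_Diff_subset)
  qed
  ultimately show ?thesis unfolding k_connected_def by blast
qed

theorem theorem4p3:
  fixes n k :: nat
  assumes "k \<ge> 1" and "n - 1 > k"
  shows "let q = \<lfloor>(real n + real k - 2) / real k\<rfloor>;
             B = 1 / 4 * real n * of_int q * (2 * real n + real k - 2 - real k * of_int q)
         in (\<forall>G :: ('a, 'b) pre_digraph.
               graph G \<and> k_connected k G \<and> card (verts G) = n \<longrightarrow> real (wiener_index G) \<le> B) \<and>
            (k \<ge> 2 \<and> even k \<longrightarrow>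
               graph (with_proj (harary k n)) \<and> k_connected k (with_proj (harary k n)) \<and>
               card (verts (with_proj (harary k n))) = n \<and>
               real (wiener_index (with_proj (harary k n))) = B)"
proof -
  let ?H = "with_proj (harary k n)"
  define q where "q = (n + k - 2) div k"
  define s where "s = (\<Sum>i<n. n - 1 - k * i)"
  define B where "B = 1 / 4 * real n * real q * (2 * real n + real k - 2 - real k * real q)"
  \<comment> \<open>The natural subtraction is exact here, which turns the floor into
    \<open>div\<close>.\<close>
  have "\<lfloor>(real n + real k - 2) / real k\<rfloor> = \<lfloor>real (n + k - 2) / real k\<rfloor>"
    using assms by simp
  also have "\<dots> = int q"
    unfolding q_def by (rule floor_divide_of_nat_eq)
  finally have floor_eq: "\<lfloor>(real n + real k - 2) / real k\<rfloor> = int q" .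
  have "2 * real s = real q * (2 * real n + real k - 2 - real k * real q)"
    unfolding s_def using assms by (intro sum_truncated_arith_progression) (auto simp: q_def)
  then have "real n * (2 * real s) = 4 * B"
    unfolding B_def by simp
  \<comment> \<open>Both estimates bound twice the Wiener index by \<open>n * s\<close>, so this one
    identity serves the inequality and the equality case.\<close>
  then have B: "real (n * s) = 2 * B" by simp
  have upper: "real (wiener_index G) \<le> B"
    if "graph G" "k_connected k G" "card (verts G) = n" for G :: "('a, 'b) pre_digraph"
  proof -
    have "2 * wiener_index G \<le> n * s"
      using graph.double_wiener_index_le[of G k] that assms by (simp add: s_def)
    from of_nat_mono[OF this, where 'a = real] B show ?thesis by simp
  qed
  have equality: "graph ?H \<and> k_connected k ?H \<and> card (verts ?H) = n \<and> real (wiener_index ?H) = B"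
    if k: "k \<ge> 2 \<and> even k"
  proof -
    have "graph ?H" using assms by (intro graph_harary) simp
    moreover have conn: "k_connected k ?H" using assms k by (intro k_connected_harary) auto
    moreover have card: "card (verts ?H) = n" by (simp add: harary_def)
    moreover have "2 * wiener_index ?H = n * s"
    proof (rule antisym)
      show "2 * wiener_index ?H \<le> n * s"
        using graph.double_wiener_index_le[OF \<open>graph ?H\<close> conn] card assms by (simp add: s_def)
      show "n * s \<le> 2 * wiener_index ?H"
        \<comment> \<open>Evenness turns \<open>2 * (k div 2)\<close> into \<open>k\<close>, so the
          lower bound is the same sum \<open>s\<close>.\<close>
        using double_wiener_index_harary_ge[of k n] conn k assms
        by (simp add: s_def k_connected_def)
    qed
    then have "real (wiener_index ?H) = B"
      using B by (simp flip: \<open>2 * wiener_index ?H = n * s\<close>)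
    ultimately show ?thesis by blast
  qed
  show ?thesis
    unfolding floor_eq Let_def using upper equality by (simp add: B_def)
qed

end
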